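(* Let $R$ be a finite commutative ring with identity with $R= R_1\times R_2\times\cdots\times R_k$, and put $n=|R|$ and $n_i=|R_i|$ for $1\le i\le k$. Let $F\in R[x]$ be a polynomial and let $F_1\in R_1[x],\ldots,F_k\in R_k[x]$ be the polynomials corresponding to $F$ under the isomorphism $R[x]\cong R_1[x]\times\cdots\times R_k[x]$. For $1\le i\le k$ let $a_i\ge 0$ be the number of elements of $R_i$ that are not roots of $F_i$. Then the number of elements of $R$ that are not roots of $F$ is $$\sum_{i=1}^{k}\ \sum_{1\le j_1<j_2<\cdots<j_i\le k}\frac{(-1)^{i+1}\,n\cdot a_{j_1}a_{j_2}\cdots a_{j_i}}{n_{j_1}n_{j_2}\cdots n_{j_i}}.$$
   Context: The isomorphism $R[x]\cong R_1[x]\times\cdots\times R_k[x]$ is the natural one applying the projections $R\to R_i$ to the coefficients, so $F_i$ is obtained from $F$ by replacing each coefficient by its $i$-th component. An element $r$ is a root of a polynomial $F$ if $F(r)=0$. *)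

theory Defs
  imports Complex_Main "HOL-Algebra.Chinese_Remainder" "HOL-Algebra.UnivPoly"
begin

(* Polynomials over R are the elements of carrier (UP R). The predicate ring.is_root of
   HOL-Algebra is not suitable here: it declares that the zero polynomial has no roots,
   whereas every element is a root of it in the sense F(r) = 0 used below. *)

definition poly_root :: "('a, 'm) ring_scheme \<Rightarrow> (nat \<Rightarrow> 'a) \<Rightarrow> 'a \<Rightarrow> bool" where
  "poly_root R F r \<longleftrightarrow> r \<in> carrier R \<and> eval R R id r F = \<zero>\<^bsub>R\<^esub>"

definition non_roots :: "('a, 'm) ring_scheme \<Rightarrow> (nat \<Rightarrow> 'a) \<Rightarrow> 'a set" where
  "non_roots R F = {r \<in> carrier R. \<not> poly_root R F r}"

(* Elements of RDirProd_list Rs are lists, and the projection to the i-th factor (counting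
   from 0) is (\<lambda>r. r ! i); it is applied here to every coefficient of F. *)

definition component_poly :: "'a ring list \<Rightarrow> (nat \<Rightarrow> 'a list) \<Rightarrow> nat \<Rightarrow> (nat \<Rightarrow> 'a)" where
  "component_poly Rs F i = (\<lambda>m. coeff (UP (RDirProd_list Rs)) F m ! i)"

end

theory Submission
  imports Defs
begin

text \<open>
  It is easier to count the roots than the non-roots. Each projection of the product ring is a
  ring homomorphism, and evaluation of polynomials commutes with ring homomorphisms
  (\<open>hom_eval\<close>), so the \<open>i\<close>-th component of \<open>F(r)\<close> is \<open>F\<^sub>i(r\<^sub>i)\<close>. A tuple is zero precisely when all its
  components are, hence the root set of \<open>F\<close> is the Cartesian product of the root sets of the \<open>F\<^sub>i\<close>.
  It has \<open>\<Prod>\<^sub>i (n\<^sub>i - a\<^sub>i) = n \<Prod>\<^sub>i (1 - a\<^sub>i / n\<^sub>i)\<close> elements (\<open>card_lists_componentwise\<close>), and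
  the complement has \<open>n (1 - \<Prod>\<^sub>i (1 - a\<^sub>i / n\<^sub>i))\<close>. Multiplying the product out over subsets of the
  index set and grouping these by cardinality (\<open>one_minus_prod_one_minus\<close>) gives the alternating sum.
\<close>

text \<open>
  The operations of \<open>RDirProd_list\<close> come from an image ring along \<open>(a, as) \<mapsto> a # as\<close>, whose operations
  use an inverse of that map; they are componentwise because the map is an isomorphism.
\<close>

lemma RDirProd_list_Cons_ops:
  assumes "x \<in> carrier (RDirProd_list (S # Rs))" "y \<in> carrier (RDirProd_list (S # Rs))"
  shows "x \<oplus>\<^bsub>RDirProd_list (S # Rs)\<^esub> y = (hd x \<oplus>\<^bsub>S\<^esub> hd y) # (tl x \<oplus>\<^bsub>RDirProd_list Rs\<^esub> tl y)"
    and "x \<otimes>\<^bsub>RDirProd_list (S # Rs)\<^esub> y = (hd x \<otimes>\<^bsub>S\<^esub> hd y) # (tl x \<otimes>\<^bsub>RDirProd_list Rs\<^esub> tl y)"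
proof -
  let ?c = "\<lambda>(a, as). a # as" and ?D = "RDirProd S (RDirProd_list Rs)"
  obtain a as where x: "x = a # as" "(a, as) \<in> carrier ?D"
    using assms(1) by (auto simp: RDirProd_list_carrier RDirProd_carrier)
  obtain b bs where y: "y = b # bs" "(b, bs) \<in> carrier ?D"
    using assms(2) by (auto simp: RDirProd_list_carrier RDirProd_carrier)
  have ops: "(a, as) \<oplus>\<^bsub>?D\<^esub> (b, bs) = (a \<oplus>\<^bsub>S\<^esub> b, as \<oplus>\<^bsub>RDirProd_list Rs\<^esub> bs)"
    "(a, as) \<otimes>\<^bsub>?D\<^esub> (b, bs) = (a \<otimes>\<^bsub>S\<^esub> b, as \<otimes>\<^bsub>RDirProd_list Rs\<^esub> bs)"
    by (auto simp: RDirProd_def DirProd_def monoid.defs)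
  show "x \<oplus>\<^bsub>RDirProd_list (S # Rs)\<^esub> y = (hd x \<oplus>\<^bsub>S\<^esub> hd y) # (tl x \<oplus>\<^bsub>RDirProd_list Rs\<^esub> tl y)"
    using ring_hom_add[OF RDirProd_list_hom1 x(2) y(2)] by (simp add: x y ops)
  show "x \<otimes>\<^bsub>RDirProd_list (S # Rs)\<^esub> y = (hd x \<otimes>\<^bsub>S\<^esub> hd y) # (tl x \<otimes>\<^bsub>RDirProd_list Rs\<^esub> tl y)"
    using ring_hom_mult[OF RDirProd_list_hom1 x(2) y(2)] by (simp add: x y ops)
qed

lemma RDirProd_list_proj_hom:
  assumes "i < length Rs"
  shows "(\<lambda>r. r ! i) \<in> ring_hom (RDirProd_list Rs) (Rs ! i)"
  using assms
proof (induction Rs arbitrary: i)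
  case (Cons S Rs)
  have tl_carrier: "tl x \<in> carrier (RDirProd_list Rs)" "x = hd x # tl x"
    if "x \<in> carrier (RDirProd_list (S # Rs))" for x
    using that by (auto simp: RDirProd_list_carrier)
  show ?case
  proof (rule ring_hom_memI)
    fix x y assume xy: "x \<in> carrier (RDirProd_list (S # Rs))" "y \<in> carrier (RDirProd_list (S # Rs))"
    show "x ! i \<in> carrier ((S # Rs) ! i)"
      using RDirProd_list_carrier_mem(2)[OF xy(1) Cons.prems] .
    have nth: "x ! i = (case i of 0 \<Rightarrow> hd x | Suc j \<Rightarrow> tl x ! j)"
      "y ! i = (case i of 0 \<Rightarrow> hd y | Suc j \<Rightarrow> tl y ! j)"
      using tl_carrier(2) xy by (metis nth_Cons)+
    show "(x \<otimes>\<^bsub>RDirProd_list (S # Rs)\<^esub> y) ! i = x ! i \<otimes>\<^bsub>(S # Rs) ! i\<^esub> y ! i"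
      using Cons ring_hom_mult[OF Cons.IH tl_carrier(1)[OF xy(1)] tl_carrier(1)[OF xy(2)]]
      by (auto simp: RDirProd_list_Cons_ops[OF xy] nth split: nat.split)
    show "(x \<oplus>\<^bsub>RDirProd_list (S # Rs)\<^esub> y) ! i = x ! i \<oplus>\<^bsub>(S # Rs) ! i\<^esub> y ! i"
      using Cons ring_hom_add[OF Cons.IH tl_carrier(1)[OF xy(1)] tl_carrier(1)[OF xy(2)]]
      by (auto simp: RDirProd_list_Cons_ops[OF xy] nth split: nat.split)
  next
    show "\<one>\<^bsub>RDirProd_list (S # Rs)\<^esub> ! i = \<one>\<^bsub>(S # Rs) ! i\<^esub>"
      using Cons ring_hom_one[OF Cons.IH]
      by (auto simp: RDirProd_list_one nth_Cons split: nat.split)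
  qed
qed simp

text \<open>
  Evaluation sums up to the exact degree, which can drop when the coefficients are mapped into
  another ring. Allowing any larger bound lets \<open>F\<close> and its image be summed over the same range.
\<close>

lemma (in UP_cring) eval_id_bound:
  assumes p: "p \<in> carrier P" and n: "deg R p \<le> n" and x: "x \<in> carrier R"
  shows "eval R R id x p = (\<Oplus>i\<in>{..n}. coeff P p i \<otimes> x [^] i)"
proof -
  have "(\<Oplus>i\<in>{..deg R p}. coeff P p i \<otimes> x [^] i)
      = (\<Oplus>i\<in>{..n}. coeff P p i \<otimes> x [^] i)"
    by (rule R.add.finprod_mono_neutral_cong_left)
       (use n p x in \<open>auto simp: deg_aboveD\<close>)
  then show ?thesis
    using eval_on_carrier[OF p, of R id x] by simp
qed

lemma (in ring_hom_cring) hom_eval: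
  assumes F: "F \<in> carrier (UP R)" and r: "r \<in> carrier R"
  shows "h \<circ> F \<in> carrier (UP S)" and "eval S S id (h r) (h \<circ> F) = h (eval R R id r F)"
proof -
  interpret R: UP_cring R "UP R" by unfold_locales
  interpret S: UP_cring S "UP S" by unfold_locales
  have coeffF: "coeff (UP R) F m = F m" for m
    using F by (simp add: UP_def)
  have F_closed: "F m \<in> carrier R" for m
    using R.coeff_closed[OF F, of m] by (simp add: coeffF)
  have vanish: "F m = \<zero>\<^bsub>R\<^esub>" if "deg R F < m" for m
    using R.deg_aboveD[OF that F] by (simp add: coeffF)
  show hF: "h \<circ> F \<in> carrier (UP S)"
    using F_closed vanish by (auto simp: UP_def up_def bound_def intro!: exI[of _ "deg R F"])
  have coeffhF: "coeff (UP S) (h \<circ> F) m = h (F m)" for m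
    using hF by (simp add: UP_def)
  have "deg S (h \<circ> F) \<le> deg R F"
    by (rule S.deg_aboveI) (simp_all add: hF coeffhF vanish)
  then have "eval S S id (h r) (h \<circ> F) = (\<Oplus>\<^bsub>S\<^esub>m\<in>{..deg R F}. h (F m) \<otimes>\<^bsub>S\<^esub> h r [^]\<^bsub>S\<^esub> m)"
    using S.eval_id_bound[OF hF _ hom_closed[OF r]] by (simp add: coeffhF)
  also have "\<dots> = h (\<Oplus>\<^bsub>R\<^esub>m\<in>{..deg R F}. F m \<otimes>\<^bsub>R\<^esub> r [^]\<^bsub>R\<^esub> m)"
    using F_closed r by (simp add: Pi_def o_def cong: S.finsum_cong)
  finally show "eval S S id (h r) (h \<circ> F) = h (eval R R id r F)"
    using R.eval_id_bound[OF F order.refl r] by (simp add: coeffF)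
qed

lemma card_lists_componentwise:
  "card {xs. length xs = k \<and> (\<forall>i<k. xs ! i \<in> A i)} = (\<Prod>i<k. card (A i))"
proof -
  have "bij_betw (\<lambda>f. map f [0..<k]) (PiE {..<k} A) {xs. length xs = k \<and> (\<forall>i<k. xs ! i \<in> A i)}"
    by (rule bij_betwI[where g = "\<lambda>xs. restrict (nth xs) {..<k}"])
       (auto simp: PiE_iff extensional_def fun_eq_iff intro!: nth_equalityI)
  from bij_betw_same_card[OF this] show ?thesis
    by (simp add: card_PiE)
qed

text \<open>
  The empty subset contributes the term \<open>1\<close> to the expanded product; it cancels against the leading
  \<open>1\<close>, so that the outer sum starts at \<open>i = 1\<close>.
\<close>

lemma one_minus_prod_one_minus:
  fixes x :: "nat \<Rightarrow> 'b::comm_ring_1"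
  shows "1 - (\<Prod>j<k. 1 - x j) =
    (\<Sum>i = 1..k. \<Sum>J | J \<subseteq> {..<k} \<and> card J = i. (-1) ^ (i + 1) * (\<Prod>j\<in>J. x j))"
proof -
  let ?g = "\<lambda>J. (-1) ^ card J * (\<Prod>j\<in>J. x j)"
  have "(\<Prod>j<k. 1 - x j) = (\<Sum>J\<in>Pow {..<k}. ?g J)"
    using prod_diff_conv_sum[of "{..<k}" "\<lambda>_. 1" x] by simp
  also have "\<dots> = (\<Sum>i\<in>{0..k}. \<Sum>J | J \<in> Pow {..<k} \<and> card J = i. ?g J)"
    by (rule sum.group[symmetric]) (auto dest: card_mono[OF finite_lessThan])
  also have "\<dots> = 1 + (\<Sum>i=1..k. \<Sum>J | J \<subseteq> {..<k} \<and> card J = i. ?g J)"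
  proof -
    have "{J. J \<subseteq> {..<k} \<and> card J = 0} = {{}}"
      by (auto dest: finite_subset[OF _ finite_lessThan])
    then show ?thesis
      by (simp add: sum.atLeast_Suc_atMost)
  qed
  finally show ?thesis
    by (simp add: sum_negf[symmetric])
qed

theorem mainTheorem5:
  fixes R :: "'a list ring" and Rs :: "'a ring list" and k :: nat
    and F :: "nat \<Rightarrow> 'a list" and Fs :: "nat \<Rightarrow> nat \<Rightarrow> 'a"
    and n :: nat and ns a :: "nat \<Rightarrow> nat"
  assumes "cring R" and "finite (carrier R)"
    and "k = length Rs" and "k \<ge> 1"
    and "\<And>i. i < k \<Longrightarrow> cring (Rs ! i)"
    and "R = RDirProd_list Rs"
    and "n = card (carrier R)"
    and "\<And>i. i < k \<Longrightarrow> ns i = card (carrier (Rs ! i))"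
    and "F \<in> carrier (UP R)"
    and "\<And>i. i < k \<Longrightarrow> Fs i = component_poly Rs F i"
    and "\<And>i. i < k \<Longrightarrow> a i = card (non_roots (Rs ! i) (Fs i))"
  shows "real (card (non_roots R F)) =
    (\<Sum>i = 1..k. \<Sum>J | J \<subseteq> {..<k} \<and> card J = i.
      (-1) ^ (i + 1) * real n * (\<Prod>j\<in>J. real (a j)) / (\<Prod>j\<in>J. real (ns j)))"
proof -
  interpret R: cring R by fact
  define roots where "roots i = carrier (Rs ! i) - non_roots (Rs ! i) (Fs i)" for i
  have carrier_R: "carrier R = {r. length r = k \<and> (\<forall>i<k. r ! i \<in> carrier (Rs ! i))}"
    using RDirProd_list_carrier_mem[of _ Rs] RDirProd_list_carrier_memI[of _ Rs]
    unfolding assms(3,6) by blast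
  have n: "n = (\<Prod>i<k. ns i)"
    using assms(8) by (simp add: assms(7) carrier_R card_lists_componentwise)
  \<comment> \<open>Each factor inherits finiteness from the product: an infinite factor has \<open>card\<close> equal to \<open>0\<close>,
    which would make \<open>n\<close> vanish, whereas \<open>R\<close> contains zero.\<close>
  have "n > 0"
    using assms(2) by (auto simp: assms(7) card_gt_0_iff)
  then have ns_pos: "ns i > 0" if "i < k" for i
    using that n by (metis finite_lessThan gr0I lessThan_iff prod_zero_iff)
  have hom: "ring_hom_cring R (Rs ! i) (\<lambda>r. r ! i)" if "i < k" for i
    using RDirProd_list_proj_hom[of i Rs] that assms(1,3,5,6)
    by (simp add: ring_hom_cring_def ring_hom_cring_axioms_def)
  have Fs: "Fs i = (\<lambda>r. r ! i) \<circ> F" if "i < k" for i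
    using assms(9) assms(10)[OF that] by (auto simp: component_poly_def UP_def assms(6))
  have root_iff: "poly_root R F r \<longleftrightarrow> (\<forall>i<k. r ! i \<in> roots i)" if r: "r \<in> carrier R" for r
  proof -
    interpret UP_cring R "UP R" by unfold_locales
    have ev: "eval R R id r F \<in> carrier R"
      using eval_id_bound[OF assms(9) order.refl r] coeff_closed[OF assms(9)] r
      by (simp add: Pi_def)
    have "poly_root R F r \<longleftrightarrow> (\<forall>i<k. eval R R id r F ! i = \<zero>\<^bsub>R\<^esub> ! i)"
      using r ev R.zero_closed by (auto simp: poly_root_def carrier_R intro: nth_equalityI)
    also have "\<dots> \<longleftrightarrow> (\<forall>i<k. eval (Rs ! i) (Rs ! i) id (r ! i) (Fs i) = \<zero>\<^bsub>Rs ! i\<^esub>)"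
    proof (intro all_cong)
      fix i assume i: "i < k"
      interpret ring_hom_cring R "Rs ! i" "\<lambda>r. r ! i" by (rule hom[OF i])
      show "eval R R id r F ! i = \<zero>\<^bsub>R\<^esub> ! i
          \<longleftrightarrow> eval (Rs ! i) (Rs ! i) id (r ! i) (Fs i) = \<zero>\<^bsub>Rs ! i\<^esub>"
        using hom_eval(2)[OF assms(9) r] hom_zero by (simp add: Fs[OF i])
    qed
    also have "\<dots> \<longleftrightarrow> (\<forall>i<k. r ! i \<in> roots i)"
      using r by (auto simp: carrier_R roots_def non_roots_def poly_root_def)
    finally show ?thesis .
  qed
  have card_roots: "real (card (roots i)) = real (ns i) * (1 - real (a i) / real (ns i))"
    if "i < k" for i
  proof -
    have "finite (carrier (Rs ! i))"
      using ns_pos[OF that] assms(8)[OF that] by (simp add: card_gt_0_iff)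
    moreover have "non_roots (Rs ! i) (Fs i) \<subseteq> carrier (Rs ! i)"
      by (auto simp: non_roots_def)
    ultimately have "real (card (roots i)) = real (ns i) - real (a i)"
      using that assms(8,11)
      by (simp add: roots_def card_Diff_subset finite_subset of_nat_diff card_mono)
    then show ?thesis
      using ns_pos[OF that] by (simp add: right_diff_distrib)
  qed
  define Z where "Z = {r. length r = k \<and> (\<forall>i<k. r ! i \<in> roots i)}"
  have Z: "Z \<subseteq> carrier R" "non_roots R F = carrier R - Z"
    using root_iff by (auto simp: Z_def non_roots_def carrier_R roots_def)
  have "real (card (non_roots R F)) = real n - real (card Z)"
    using Z assms(2) by (simp add: card_Diff_subset finite_subset of_nat_diff card_mono assms(7))
  also have "real (card Z) = real n * (\<Prod>i<k. 1 - real (a i) / real (ns i))"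
    by (simp add: Z_def card_lists_componentwise card_roots n flip: prod.distrib)
  finally have "real (card (non_roots R F)) = real n * (1 - (\<Prod>i<k. 1 - real (a i) / real (ns i)))"
    by (simp add: algebra_simps)
  then show ?thesis
    by (simp add: one_minus_prod_one_minus sum_distrib_left prod_dividef algebra_simps)
qed

end
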